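(* Let $\Phi=(\phi_n)$ be a frame for $\mathcal H$ and let $\Phi^d=(\phi_n^d)$ be a dual frame of $\Phi$, with $\phi_n\ne0$ and $\phi_n^d\neq0$ for all $n$, and let $B_\Phi$, $B_{\Phi^d}$ be upper frame bounds of $\Phi$, $\Phi^d$ respectively. Let $0\le\lambda<\frac{1}{\sqrt{B_\Phi B_{\Phi^d}}}$ and let $m=(m_n)$ be such that $1-\lambda\le m_n\le1+\lambda$ for all $n\in\mathbb N$. Then $M_{m,\Phi,\Phi^d}$ and $M_{m,\Phi^d,\Phi}$ are invertible on $\mathcal H$ and $$\frac{1}{1+\lambda\sqrt{B_\Phi B_{\Phi^d}}}\|h\|\le\|M^{-1}h\|\le\frac{1}{1-\lambda\sqrt{B_\Phi B_{\Phi^d}}}\|h\|,\quad\forall h\in\mathcal H,$$ where $M$ denotes any one of $M_{m,\Phi,\Phi^d}$ and $M_{m,\Phi^d,\Phi}$. Moreover, $$M_{m,\Phi,\Phi^d}^{-1}=\sum_{k=0}^\infty (M_{(1-m_n),\Phi,\Phi^d})^k\quad\text{and}\quad M_{m,\Phi^d,\Phi}^{-1}=\sum_{k=0}^\infty (M_{(1-m_n),\Phi^d,\Phi})^k.$$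
   Context: $\mathcal H$ is a separable infinite-dimensional complex Hilbert space, inner product linear in the first argument; all sequences are indexed by $\mathbb N$. The multiplier is $M_{m,\Phi,\Psi}f=\sum_n m_n\langle f,\psi_n\rangle\phi_n$; it is invertible on $\mathcal H$ if the series converges for every $f\in\mathcal H$ and the resulting operator has a bounded two-sided inverse $\mathcal H\to\mathcal H$. A frame for $\mathcal H$ with bounds $A_\Phi,B_\Phi$ is a sequence $\Phi$ with $0<A_\Phi$ and $A_\Phi\|h\|^2\le\sum|\langle h,\phi_n\rangle|^2\le B_\Phi\|h\|^2$ for all $h\in\mathcal H$; $B_\Phi$ is called an upper frame bound. A dual frame of $\Phi$ is a frame $(\phi_n^d)$ for $\mathcal H$ with $h=\sum\langle h,\phi_n^d\rangle\phi_n=\sum\langle h,\phi_n\rangle\phi_n^d$ for all $h\in\mathcal H$. Infinite series of operators are understood as (Neumann) series converging in operator norm. *)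

theory Defs
  imports "HOL-Analysis.Analysis"
begin

text \<open>
  Complex inner product spaces, with the inner product linear in the first argument.  The real
  scaling is the restriction of the complex one, so that the topology, norm and series notions of
  \<^class>\<open>real_normed_vector\<close> apply.  Positive definiteness of the inner product follows
  from \<open>norm_eq_sqrt_cinner\<close> and the norm axioms.
\<close>

class complex_inner = real_normed_vector +
  fixes scaleC :: "complex \<Rightarrow> 'a \<Rightarrow> 'a"  (infixr "*\<^sub>C" 75)
    and cinner :: "'a \<Rightarrow> 'a \<Rightarrow> complex"
  assumes scaleC_add_right: "c *\<^sub>C (x + y) = c *\<^sub>C x + c *\<^sub>C y"
    and scaleC_add_left: "(c + d) *\<^sub>C x = c *\<^sub>C x + d *\<^sub>C x"
    and scaleC_scaleC: "c *\<^sub>C d *\<^sub>C x = (c * d) *\<^sub>C x"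
    and scaleR_scaleC: "r *\<^sub>R x = complex_of_real r *\<^sub>C x"
    and cinner_commute: "cinner x y = cnj (cinner y x)"
    and cinner_add_left: "cinner (x + y) z = cinner x z + cinner y z"
    and cinner_scaleC_left: "cinner (c *\<^sub>C x) y = c * cinner x y"
    and norm_eq_sqrt_cinner: "norm x = sqrt (Re (cinner x x))"

class complex_hilbert = complex_inner + complete_space

global_interpretation complex_vector:
  vector_space "scaleC :: complex \<Rightarrow> 'a \<Rightarrow> 'a::complex_inner"
proof
  fix x :: 'a
  show "1 *\<^sub>C x = x"
    using scaleR_scaleC[of 1 x] by simp
qed (simp_all add: scaleC_add_right scaleC_add_left scaleC_scaleC)

definition bounded_clinear :: "('a::complex_inner \<Rightarrow> 'a) \<Rightarrow> bool" where
  "bounded_clinear T \<longleftrightarrow> bounded_linear T \<and> (\<forall>c x. T (c *\<^sub>C x) = c *\<^sub>C T x)"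

definition frame_with_bounds ::
    "(nat \<Rightarrow> 'a::complex_inner) \<Rightarrow> real \<Rightarrow> real \<Rightarrow> bool" where
  "frame_with_bounds \<Phi> A B \<longleftrightarrow> 0 < A \<and>
     (\<forall>h. summable (\<lambda>n. (cmod (cinner h (\<Phi> n)))\<^sup>2) \<and>
          A * (norm h)\<^sup>2 \<le> (\<Sum>n. (cmod (cinner h (\<Phi> n)))\<^sup>2) \<and>
          (\<Sum>n. (cmod (cinner h (\<Phi> n)))\<^sup>2) \<le> B * (norm h)\<^sup>2)"

definition is_frame :: "(nat \<Rightarrow> 'a::complex_inner) \<Rightarrow> bool" where
  "is_frame \<Phi> \<longleftrightarrow> (\<exists>A B. frame_with_bounds \<Phi> A B)"

definition upper_frame_bound :: "(nat \<Rightarrow> 'a::complex_inner) \<Rightarrow> real \<Rightarrow> bool" where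
  "upper_frame_bound \<Phi> B \<longleftrightarrow> (\<exists>A. frame_with_bounds \<Phi> A B)"

definition dual_frame ::
    "(nat \<Rightarrow> 'a::complex_inner) \<Rightarrow> (nat \<Rightarrow> 'a) \<Rightarrow> bool" where
  "dual_frame \<Phi> \<Phi>d \<longleftrightarrow> is_frame \<Phi>d \<and>
     (\<forall>h. (\<lambda>n. cinner h (\<Phi>d n) *\<^sub>C \<Phi> n) sums h \<and>
          (\<lambda>n. cinner h (\<Phi> n) *\<^sub>C \<Phi>d n) sums h)"

text \<open>
  \<open>multiplier m \<Phi> \<Psi>\<close> is meaningful only where the series converges; that is
  \<open>multiplier_defined m \<Phi> \<Psi>\<close>.
\<close>

definition multiplier ::
    "(nat \<Rightarrow> complex) \<Rightarrow> (nat \<Rightarrow> 'a::complex_inner) \<Rightarrow> (nat \<Rightarrow> 'a) \<Rightarrow> 'a \<Rightarrow> 'a" where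
  "multiplier m \<Phi> \<Psi> f = (\<Sum>n. m n *\<^sub>C cinner f (\<Psi> n) *\<^sub>C \<Phi> n)"

definition multiplier_defined ::
    "(nat \<Rightarrow> complex) \<Rightarrow> (nat \<Rightarrow> 'a::complex_inner) \<Rightarrow> (nat \<Rightarrow> 'a) \<Rightarrow> bool" where
  "multiplier_defined m \<Phi> \<Psi> \<longleftrightarrow>
     (\<forall>f. summable (\<lambda>n. m n *\<^sub>C cinner f (\<Psi> n) *\<^sub>C \<Phi> n))"

definition multiplier_invertible ::
    "(nat \<Rightarrow> complex) \<Rightarrow> (nat \<Rightarrow> 'a::complex_inner) \<Rightarrow> (nat \<Rightarrow> 'a) \<Rightarrow> bool" where
  "multiplier_invertible m \<Phi> \<Psi> \<longleftrightarrow> multiplier_defined m \<Phi> \<Psi> \<and>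
     (\<exists>T. bounded_clinear T \<and>
          T \<circ> multiplier m \<Phi> \<Psi> = id \<and> multiplier m \<Phi> \<Psi> \<circ> T = id)"

text \<open>
  Convergence of a series of operators in operator norm.  Boundedness is part of the definition,
  because \<^const>\<open>onorm\<close> is a real number even for unbounded maps, where it has no meaning.
\<close>

definition opnorm_sums ::
    "(nat \<Rightarrow> 'a::complex_inner \<Rightarrow> 'a) \<Rightarrow> ('a \<Rightarrow> 'a) \<Rightarrow> bool" where
  "opnorm_sums F T \<longleftrightarrow> (\<forall>k. bounded_clinear (F k)) \<and> bounded_clinear T \<and>
     (\<lambda>N. onorm (\<lambda>h. (\<Sum>k<N. F k h) - T h)) \<longlonglongrightarrow> 0"

end

theory Submission
  imports Defs
begin

text \<open>
  Since \<open>\<Phi>d\<close> is dual to \<open>\<Phi>\<close>, the multiplier with symbol \<open>1\<close> is the identity, so the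
  multiplier with symbol \<open>m\<close> is \<open>I - N\<close>, where \<open>N\<close> has symbol \<open>1 - m\<close>.  A multiplier
  factors as synthesis, multiplication by the symbol, analysis; the first and last have norm at
  most the square roots of the Bessel bounds, so the norm of \<open>N\<close> is at most
  \<open>lam * sqrt (B * Bd) < 1\<close>, and the Neumann series applies.
\<close>

text \<open>Makes the comparison test and the Cauchy criterion for series, both stated for
  \<open>banach\<close>, available in a Hilbert space.\<close>

instance complex_hilbert \<subseteq> banach ..

section \<open>Complex inner product spaces\<close>

lemma cinner_zero_left [simp]: "cinner 0 (y::'a::complex_inner) = 0"
  using cinner_add_left[of "0::'a" 0 y] by simp

lemma cinner_sum_left: "cinner (\<Sum>i\<in>I. f i) (y::'a::complex_inner) = (\<Sum>i\<in>I. cinner (f i) y)"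
  by (induction I rule: infinite_finite_induct) (simp_all add: cinner_add_left)

lemma cmod_cinner_commute: "cmod (cinner x y) = cmod (cinner y (x::'a::complex_inner))"
  by (metis cinner_commute complex_mod_cnj)

lemma norm_power2_cinner: "(norm (x::'a::complex_inner))\<^sup>2 = Re (cinner x x)"
proof -
  have "Re (cinner x x) \<ge> 0"
    using norm_ge_zero[of x] unfolding norm_eq_sqrt_cinner by simp
  then show ?thesis
    unfolding norm_eq_sqrt_cinner by simp
qed

text \<open>The class gives homogeneity of the norm for real scalars. The complex case comes from
  conjugate linearity in the second argument, which \<open>cinner_commute\<close> supplies.\<close>

lemma norm_scaleC: "norm (c *\<^sub>C (x::'a::complex_inner)) = cmod c * norm x"
proof -
  have "cinner x (c *\<^sub>C x) = cnj c * cinner x x"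
    by (metis cinner_commute cinner_scaleC_left complex_cnj_mult)
  then have "cinner (c *\<^sub>C x) (c *\<^sub>C x) = complex_of_real ((cmod c)\<^sup>2) * cinner x x"
    by (simp add: cinner_scaleC_left complex_norm_square mult.assoc del: of_real_power)
  then have "(norm (c *\<^sub>C x))\<^sup>2 = (cmod c * norm x)\<^sup>2"
    by (simp add: norm_power2_cinner power_mult_distrib del: of_real_power)
  then show ?thesis
    by (simp add: power2_eq_iff_nonneg)
qed

lemma bounded_linear_scaleC: "bounded_linear (\<lambda>x::'a::complex_inner. c *\<^sub>C x)"
  by (rule bounded_linear_intro[where K = "cmod c"])
    (simp_all add: scaleC_add_right scaleR_scaleC scaleC_scaleC norm_scaleC mult.commute)

lemma bounded_clinearI:
  fixes T :: "'a::complex_inner \<Rightarrow> 'a"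
  assumes "\<And>x y. T (x + y) = T x + T y" "\<And>c x. T (c *\<^sub>C x) = c *\<^sub>C T x"
    and "\<And>x. norm (T x) \<le> K * norm x"
  shows "bounded_clinear T"
  unfolding bounded_clinear_def
  by (intro conjI bounded_linear_intro[where K = K] allI)
    (use assms in \<open>simp_all add: scaleR_scaleC mult.commute\<close>)

lemma bounded_clinear_funpow:
  assumes "bounded_clinear T"
  shows "bounded_clinear (T ^^ k)"
proof (induction k)
  case 0
  show ?case
    by (simp add: bounded_clinear_def bounded_linear_ident id_def)
next
  case (Suc k)
  then show ?case
    using assms bounded_linear_compose[of T "T ^^ k"]
    by (simp add: bounded_clinear_def comp_def)
qed

section \<open>Neumann series\<close>

lemma norm_funpow_le:
  fixes T :: "'a::real_normed_vector \<Rightarrow> 'a"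
  assumes "\<And>x. norm (T x) \<le> q * norm x" "0 \<le> q"
  shows "norm ((T ^^ k) x) \<le> q ^ k * norm x"
proof (induction k)
  case (Suc k)
  have "norm (T ((T ^^ k) x)) \<le> q * norm ((T ^^ k) x)"
    by (rule assms)
  also have "\<dots> \<le> q * (q ^ k * norm x)"
    using Suc assms(2) by (rule mult_left_mono)
  finally show ?case
    by (simp add: mult.assoc)
qed simp

text \<open>The powers are summed pointwise, dominated by a geometric series. Shifting the index
  yields T G = G T = G - I, hence both inverse identities.\<close>

lemma neumann_series:
  fixes T :: "'a::complex_hilbert \<Rightarrow> 'a"
  assumes T: "bounded_clinear T" and bound: "\<And>x. norm (T x) \<le> q * norm x"
    and q: "0 \<le> q" "q < 1"
  obtains G where "bounded_clinear G" "G \<circ> (\<lambda>x. x - T x) = id" "(\<lambda>x. x - T x) \<circ> G = id"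
    "opnorm_sums (\<lambda>k. T ^^ k) G"
proof
  define G where "G = (\<lambda>x. \<Sum>k. (T ^^ k) x)"
  interpret T: bounded_linear T
    using T by (simp add: bounded_clinear_def)
  have powC: "bounded_clinear (T ^^ k)" for k
    using T by (rule bounded_clinear_funpow)
  then have powL: "bounded_linear (T ^^ k)" for k
    by (simp add: bounded_clinear_def)
  have pow_le: "norm ((T ^^ k) x) \<le> q ^ k * norm x" for k x
    using bound q(1) by (rule norm_funpow_le)
  have geo: "(\<lambda>k. q ^ k * c) sums (c / (1 - q))" for c
    using sums_mult2[OF geometric_sums[of q], of c] q by simp
  have summ: "summable (\<lambda>k. (T ^^ k) x)" for x
    by (rule summable_comparison_test'[OF sums_summable[OF geo[of "norm x"]]]) (rule pow_le)
  have G: "(\<lambda>k. (T ^^ k) x) sums G x" for x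
    unfolding G_def using summ by (rule summable_sums)
  \<comment> \<open>The factor multiplying \<open>norm x\<close> is independent of \<open>x\<close>,
    so this pointwise bound also bounds the operator norm and drives the convergence at the end. Its
    case \<open>N = 0\<close> is the boundedness of \<open>G\<close>.\<close>
  have tail: "norm ((\<Sum>k<N. (T ^^ k) x) - G x) \<le> q ^ N / (1 - q) * norm x" for N x
  proof -
    have "norm ((\<Sum>k<N. (T ^^ k) x) - G x) = norm (\<Sum>k. (T ^^ (k + N)) x)"
      unfolding G_def suminf_split_initial_segment[OF summ, of _ N] by simp
    also have "\<dots> \<le> (\<Sum>k. q ^ k * (q ^ N * norm x))"
    proof (rule norm_suminf_le)
      show "norm ((T ^^ (k + N)) x) \<le> q ^ k * (q ^ N * norm x)" for k
        using pow_le[of "k + N" x] by (simp add: power_add mult.assoc)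
    qed (rule sums_summable[OF geo])
    also have "\<dots> = q ^ N / (1 - q) * norm x"
      using sums_unique[OF geo, of "q ^ N * norm x"] by simp
    finally show ?thesis .
  qed
  show GC: "bounded_clinear G"
  proof (rule bounded_clinearI)
    show "G (x + y) = G x + G y" for x y
      using sums_add[OF G[of x] G[of y]] G[of "x + y"]
      by (simp add: linear_add[OF bounded_linear.linear[OF powL]] sums_unique2)
    show "G (c *\<^sub>C x) = c *\<^sub>C G x" for c x
      using bounded_linear.sums[OF bounded_linear_scaleC[of c] G[of x]] G[of "c *\<^sub>C x"] powC
      by (simp add: bounded_clinear_def sums_unique2)
    show "norm (G x) \<le> 1 / (1 - q) * norm x" for x
      using tail[where N = 0 and x = x] by simp
  qed
  \<comment> \<open>The removed term at index 0 is \<open>x\<close>. The shifted series is both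
    \<open>T\<close> applied termwise to the series of \<open>G x\<close> and the series of
    \<open>G (T x)\<close>.\<close>
  have Suc_G: "(\<lambda>k. (T ^^ Suc k) x) sums (G x - x)" for x
    using sums_Suc_iff[of "\<lambda>k. (T ^^ k) x"] G[of x] by simp
  have TG: "T (G x) = G x - x" for x
    using T.sums[OF G[of x]] Suc_G[of x] by (simp add: sums_unique2)
  have GT: "G (T x) = G x - x" for x
    using G[of "T x"] Suc_G[of x] by (simp add: sums_unique2 funpow_swap1)
  interpret G: bounded_linear G
    using GC by (simp add: bounded_clinear_def)
  show "G \<circ> (\<lambda>x. x - T x) = id"
    by (simp add: fun_eq_iff G.diff GT)
  show "(\<lambda>x. x - T x) \<circ> G = id"
    by (simp add: fun_eq_iff TG)
  have "(\<lambda>N. onorm (\<lambda>h. (\<Sum>k<N. (T ^^ k) h) - G h)) \<longlonglongrightarrow> 0"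
  proof (rule tendsto_sandwich[OF always_eventually always_eventually tendsto_const])
    show "(\<lambda>N. q ^ N / (1 - q)) \<longlonglongrightarrow> 0"
      using q by (intro tendsto_divide_zero LIMSEQ_realpow_zero)
    show "\<forall>N. 0 \<le> onorm (\<lambda>h. (\<Sum>k<N. (T ^^ k) h) - G h)"
      by (intro allI onorm_pos_le bounded_linear_sub bounded_linear_sum powL G.bounded_linear)
    show "\<forall>N. onorm (\<lambda>h. (\<Sum>k<N. (T ^^ k) h) - G h) \<le> q ^ N / (1 - q)"
      using q by (intro allI onorm_bound tail) simp
  qed
  then show "opnorm_sums (\<lambda>k. T ^^ k) G"
    using powC GC by (simp add: opnorm_sums_def)
qed

section \<open>Multipliers of Bessel sequences\<close>

text \<open>The upper half of the frame condition, which feeds the norm estimates. The sign of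
  \<open>B\<close> is recorded because \<open>sqrt\<close> is negative on negative reals.\<close>

definition bessel :: "(nat \<Rightarrow> 'a::complex_inner) \<Rightarrow> real \<Rightarrow> bool" where
  "bessel \<Phi> B \<longleftrightarrow> 0 \<le> B \<and>
     (\<forall>h. summable (\<lambda>n. (cmod (cinner h (\<Phi> n)))\<^sup>2) \<and>
          (\<Sum>n. (cmod (cinner h (\<Phi> n)))\<^sup>2) \<le> B * (norm h)\<^sup>2)"

text \<open>Comparing the two frame inequalities at a nonzero vector gives A \<le> B, hence the sign
  of \<open>B\<close>. In the zero space every real number is an upper bound, so a nonzero
  \<open>x\<close> has to be supplied.\<close>

lemma upper_frame_bound_imp_bessel:
  fixes \<Phi> :: "nat \<Rightarrow> 'a::complex_inner" and x :: 'a
  assumes "upper_frame_bound \<Phi> B" "x \<noteq> 0"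
  shows "bessel \<Phi> B"
proof -
  obtain A where A: "frame_with_bounds \<Phi> A B"
    using assms(1) by (auto simp: upper_frame_bound_def)
  then have "0 < A" "A * (norm x)\<^sup>2 \<le> B * (norm x)\<^sup>2"
    unfolding frame_with_bounds_def by (blast, meson order_trans)
  then have "0 \<le> B"
    using assms(2) by (simp add: mult_le_cancel_right)
  then show ?thesis
    using A by (simp add: bessel_def frame_with_bounds_def)
qed

section \<open>Norm estimates for finite sums\<close>

lemma bessel_sum_le:
  assumes "bessel \<Phi> B" "finite I"
  shows "(\<Sum>n\<in>I. (cmod (cinner h (\<Phi> n)))\<^sup>2) \<le> B * (norm h)\<^sup>2"
proof -
  have "(\<Sum>n\<in>I. (cmod (cinner h (\<Phi> n)))\<^sup>2) \<le> (\<Sum>n. (cmod (cinner h (\<Phi> n)))\<^sup>2)"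
    using assms by (intro sum_le_suminf) (auto simp: bessel_def)
  also have "\<dots> \<le> B * (norm h)\<^sup>2"
    using assms(1) by (simp add: bessel_def)
  finally show ?thesis .
qed

text \<open>Duality: pairing the sum \<open>x\<close> with itself turns it into the coefficients
  \<open>c\<close> against the analysis coefficients of \<open>x\<close>. Cauchy-Schwarz and the
  Bessel inequality then leave one factor \<open>norm x\<close> to cancel.\<close>

lemma norm_synthesis_le:
  assumes "bessel \<Phi> B" "finite I"
  shows "norm (\<Sum>n\<in>I. c n *\<^sub>C \<Phi> n) \<le> sqrt B * L2_set (\<lambda>n. cmod (c n)) I"
proof -
  define x where "x = (\<Sum>n\<in>I. c n *\<^sub>C \<Phi> n)"
  have "(norm x)\<^sup>2 \<le> cmod (cinner x x)"
    by (simp add: norm_power2_cinner complex_Re_le_cmod)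
  also have "cinner x x = (\<Sum>n\<in>I. c n * cinner (\<Phi> n) x)"
    \<comment> \<open>Only the first argument is expanded; the second stays \<open>x\<close>, so
      that the Bessel inequality can be applied to it.\<close>
    by (subst (1) x_def) (simp add: cinner_sum_left cinner_scaleC_left)
  also have "cmod \<dots> \<le> (\<Sum>n\<in>I. \<bar>cmod (c n)\<bar> * \<bar>cmod (cinner x (\<Phi> n))\<bar>)"
    by (rule order_trans[OF norm_sum]) (simp add: norm_mult cmod_cinner_commute)
  also have "\<dots> \<le> L2_set (\<lambda>n. cmod (c n)) I * L2_set (\<lambda>n. cmod (cinner x (\<Phi> n))) I"
    by (rule L2_set_mult_ineq)
  also have "\<dots> \<le> L2_set (\<lambda>n. cmod (c n)) I * sqrt (B * (norm x)\<^sup>2)"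
  proof (rule mult_left_mono[OF _ L2_set_nonneg])
    show "L2_set (\<lambda>n. cmod (cinner x (\<Phi> n))) I \<le> sqrt (B * (norm x)\<^sup>2)"
      unfolding L2_set_def using bessel_sum_le[OF assms] by (rule real_sqrt_le_mono)
  qed
  also have "\<dots> = (sqrt B * L2_set (\<lambda>n. cmod (c n)) I) * norm x"
    by (simp add: real_sqrt_mult)
  finally have "norm x * norm x \<le> (sqrt B * L2_set (\<lambda>n. cmod (c n)) I) * norm x"
    by (simp only: power2_eq_square)
  \<comment> \<open>Settles the case \<open>x = 0\<close>, where \<open>norm x\<close> cannot be
    cancelled.\<close>
  moreover have "0 \<le> sqrt B * L2_set (\<lambda>n. cmod (c n)) I"
    using assms(1) by (simp add: bessel_def L2_set_nonneg)
  ultimately show ?thesis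
    unfolding x_def[symmetric] by (cases "x = 0") (auto simp: mult_le_cancel_right)
qed

text \<open>The analysis factor is kept as an l2 norm over \<open>I\<close>: over late blocks it
  becomes small, which gives convergence, and over initial segments it is bounded, which gives the
  operator bound.\<close>

lemma norm_multiplier_sum_le:
  assumes "bessel \<Phi> B" "finite I" "\<And>n. cmod (w n) \<le> r"
  shows "norm (\<Sum>n\<in>I. w n *\<^sub>C cinner f (\<Psi> n) *\<^sub>C \<Phi> n)
    \<le> r * sqrt B * L2_set (\<lambda>n. cmod (cinner f (\<Psi> n))) I"
proof -
  have r: "0 \<le> r"
    using assms(3)[of 0] norm_ge_zero order_trans by blast
  have "norm (\<Sum>n\<in>I. (w n * cinner f (\<Psi> n)) *\<^sub>C \<Phi> n)
      \<le> sqrt B * L2_set (\<lambda>n. cmod (w n * cinner f (\<Psi> n))) I"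
    using assms(1,2) by (rule norm_synthesis_le)
  also have "\<dots> \<le> sqrt B * L2_set (\<lambda>n. r * cmod (cinner f (\<Psi> n))) I"
    using assms by (intro mult_left_mono L2_set_mono)
      (auto simp: norm_mult bessel_def intro: mult_right_mono)
  also have "\<dots> = r * sqrt B * L2_set (\<lambda>n. cmod (cinner f (\<Psi> n))) I"
    using r by (simp add: L2_set_right_distrib)
  finally show ?thesis
    by (simp add: scaleC_scaleC)
qed

text \<open>Cauchy criterion: each block of the series is controlled by the same block of the
  convergent series of squared analysis coefficients of \<open>f\<close>.\<close>

lemma multiplier_defined_bessel:
  fixes \<Phi> \<Psi> :: "nat \<Rightarrow> 'a::complex_hilbert"
  assumes "bessel \<Phi> B" "bessel \<Psi> C" "\<And>n. cmod (w n) \<le> r"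
  shows "multiplier_defined w \<Phi> \<Psi>"
  unfolding multiplier_defined_def summable_Cauchy
proof (intro allI impI)
  fix f :: 'a and e :: real
  assume e: "0 < e"
  define K where "K = r * sqrt B"
  have "0 \<le> r"
    using assms(3)[of 0] norm_ge_zero order_trans by blast
  then have K: "0 \<le> K"
    using assms(1) by (simp add: K_def bessel_def)
  have "summable (\<lambda>n. (cmod (cinner f (\<Psi> n)))\<^sup>2)"
    using assms(2) by (simp add: bessel_def)
  \<comment> \<open>The square anticipates the root in \<open>L2_set\<close>. Dividing by
    \<open>K + 1\<close> covers \<open>K = 0\<close> and makes the final inequality strict.\<close>
  moreover have "0 < (e / (K + 1))\<^sup>2"
    using e K by simp
  ultimately obtain N where
    N: "norm (\<Sum>n=a..<b. (cmod (cinner f (\<Psi> n)))\<^sup>2) < (e / (K + 1))\<^sup>2" if "a \<ge> N" for a b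
    unfolding summable_Cauchy by blast
  have "norm (\<Sum>n=a..<b. w n *\<^sub>C cinner f (\<Psi> n) *\<^sub>C \<Phi> n) < e" if "a \<ge> N" for a b
  proof -
    have "(\<Sum>n=a..<b. (cmod (cinner f (\<Psi> n)))\<^sup>2) < (e / (K + 1))\<^sup>2"
      using N[OF that, of b] by simp
    then have "L2_set (\<lambda>n. cmod (cinner f (\<Psi> n))) {a..<b} < sqrt ((e / (K + 1))\<^sup>2)"
      unfolding L2_set_def by (rule real_sqrt_less_mono)
    also have "\<dots> = e / (K + 1)"
      using e K by simp
    finally have L: "L2_set (\<lambda>n. cmod (cinner f (\<Psi> n))) {a..<b} < e / (K + 1)" .
    have "norm (\<Sum>n=a..<b. w n *\<^sub>C cinner f (\<Psi> n) *\<^sub>C \<Phi> n)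
        \<le> K * L2_set (\<lambda>n. cmod (cinner f (\<Psi> n))) {a..<b}"
      unfolding K_def using assms(1) _ assms(3) by (rule norm_multiplier_sum_le) simp
    also have "\<dots> \<le> K * (e / (K + 1))"
      using L K by (intro mult_left_mono) auto
    also have "\<dots> < e"
      using e K by (simp add: field_simps)
    finally show ?thesis .
  qed
  then show "\<exists>N. \<forall>a\<ge>N. \<forall>b. norm (\<Sum>n=a..<b. w n *\<^sub>C cinner f (\<Psi> n) *\<^sub>C \<Phi> n) < e"
    by blast
qed

section \<open>Multipliers as bounded operators\<close>

lemma multiplier_sums:
  assumes "multiplier_defined w \<Phi> \<Psi>"
  shows "(\<lambda>n. w n *\<^sub>C cinner f (\<Psi> n) *\<^sub>C \<Phi> n) sums multiplier w \<Phi> \<Psi> f"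
  using assms unfolding multiplier_def multiplier_defined_def by (simp add: summable_sums)

lemma norm_multiplier_le:
  fixes \<Phi> \<Psi> :: "nat \<Rightarrow> 'a::complex_hilbert"
  assumes "bessel \<Phi> B" "bessel \<Psi> C" "\<And>n. cmod (w n) \<le> r"
  shows "norm (multiplier w \<Phi> \<Psi> f) \<le> r * sqrt (B * C) * norm f"
proof (rule LIMSEQ_le_const2)
  show "(\<lambda>N. norm (\<Sum>n<N. w n *\<^sub>C cinner f (\<Psi> n) *\<^sub>C \<Phi> n))
      \<longlonglongrightarrow> norm (multiplier w \<Phi> \<Psi> f)"
    using multiplier_sums[OF multiplier_defined_bessel[OF assms]]
    unfolding sums_def by (rule tendsto_norm)
  have r: "0 \<le> r"
    using assms(3)[of 0] norm_ge_zero order_trans by blast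
  have "norm (\<Sum>n<N. w n *\<^sub>C cinner f (\<Psi> n) *\<^sub>C \<Phi> n) \<le> r * sqrt (B * C) * norm f" for N
  proof -
    have "norm (\<Sum>n<N. w n *\<^sub>C cinner f (\<Psi> n) *\<^sub>C \<Phi> n)
        \<le> r * sqrt B * L2_set (\<lambda>n. cmod (cinner f (\<Psi> n))) {..<N}"
      using assms(1) _ assms(3) by (rule norm_multiplier_sum_le) simp
    also have "\<dots> \<le> r * sqrt B * sqrt (C * (norm f)\<^sup>2)"
      unfolding L2_set_def using r assms(1) bessel_sum_le[OF assms(2)]
      by (intro mult_left_mono real_sqrt_le_mono) (simp_all add: bessel_def)
    also have "\<dots> = r * sqrt (B * C) * norm f"
      by (simp add: real_sqrt_mult)
    finally show ?thesis .
  qed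
  then show "\<exists>N0. \<forall>N\<ge>N0. norm (\<Sum>n<N. w n *\<^sub>C cinner f (\<Psi> n) *\<^sub>C \<Phi> n)
      \<le> r * sqrt (B * C) * norm f"
    by blast
qed

lemma bounded_clinear_multiplier:
  fixes \<Phi> \<Psi> :: "nat \<Rightarrow> 'a::complex_hilbert"
  assumes "bessel \<Phi> B" "bessel \<Psi> C" "\<And>n. cmod (w n) \<le> r"
  shows "bounded_clinear (multiplier w \<Phi> \<Psi>)"
proof (rule bounded_clinearI)
  have "multiplier_defined w \<Phi> \<Psi>"
    using assms by (rule multiplier_defined_bessel)
  note S = multiplier_sums[OF this]
  show "multiplier w \<Phi> \<Psi> (f + g) = multiplier w \<Phi> \<Psi> f + multiplier w \<Phi> \<Psi> g" for f g
    using sums_unique2[OF S[of "f + g"]] sums_add[OF S[of f] S[of g]]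
    by (simp add: cinner_add_left scaleC_add_left scaleC_add_right)
  show "multiplier w \<Phi> \<Psi> (c *\<^sub>C f) = c *\<^sub>C multiplier w \<Phi> \<Psi> f" for c f
    using sums_unique2[OF S[of "c *\<^sub>C f"]] bounded_linear.sums[OF bounded_linear_scaleC[of c] S[of f]]
    by (simp add: cinner_scaleC_left scaleC_scaleC mult_ac)
  show "norm (multiplier w \<Phi> \<Psi> f) \<le> r * sqrt (B * C) * norm f" for f
    using assms by (rule norm_multiplier_le)
qed

text \<open>Stated for a pair of Bessel sequences with one reconstruction formula, so that it can be
  applied to a dual pair in either order.\<close>

lemma multiplier_near_one:
  fixes \<Phi> \<Psi> :: "nat \<Rightarrow> 'a::complex_hilbert" and m :: "nat \<Rightarrow> real"
  assumes \<Phi>: "bessel \<Phi> B" and \<Psi>: "bessel \<Psi> C"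
    and reconstruct: "\<And>h. (\<lambda>n. cinner h (\<Psi> n) *\<^sub>C \<Phi> n) sums h"
    and m: "\<And>n. \<bar>1 - m n\<bar> \<le> r" and q: "r * sqrt (B * C) < 1"
  defines "M \<equiv> multiplier (\<lambda>n. complex_of_real (m n)) \<Phi> \<Psi>"
    and "N \<equiv> multiplier (\<lambda>n. complex_of_real (1 - m n)) \<Phi> \<Psi>"
  shows "multiplier_invertible (\<lambda>n. complex_of_real (m n)) \<Phi> \<Psi>"
    and "multiplier_defined (\<lambda>n. complex_of_real (1 - m n)) \<Phi> \<Psi>"
    and "opnorm_sums (\<lambda>k. N ^^ k) (inv M)"
    and "1 / (1 + r * sqrt (B * C)) * norm h \<le> norm (inv M h)"
    and "norm (inv M h) \<le> 1 / (1 - r * sqrt (B * C)) * norm h"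
proof -
  define q where "q = r * sqrt (B * C)"
  have "0 \<le> r"
    using m[of 0] abs_ge_zero order_trans by blast
  then have q0: "0 \<le> q" and q1: "q < 1"
    using \<Phi> \<Psi> q by (simp_all add: q_def bessel_def)
  have w: "cmod (complex_of_real (1 - m n)) \<le> r" for n
    using m[of n] unfolding norm_of_real .
  show N_def': "multiplier_defined (\<lambda>n. complex_of_real (1 - m n)) \<Phi> \<Psi>"
    using \<Phi> \<Psi> w by (rule multiplier_defined_bessel)
  have "bounded_clinear N"
    unfolding N_def using \<Phi> \<Psi> w by (rule bounded_clinear_multiplier)
  moreover have N_le: "norm (N x) \<le> q * norm x" for x
    unfolding N_def q_def using \<Phi> \<Psi> w by (rule norm_multiplier_le)
  ultimately obtain G where G: "bounded_clinear G" "G \<circ> (\<lambda>x. x - N x) = id"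
    "(\<lambda>x. x - N x) \<circ> G = id" "opnorm_sums (\<lambda>k. N ^^ k) G"
    using q0 q1 by (rule neumann_series)
  \<comment> \<open>Subtracting the series of \<open>N\<close> termwise from the reconstruction
    formula identifies M with I - N and at the same time proves that the series of M converges, as
    invertibility demands.\<close>
  have M_sums: "(\<lambda>n. complex_of_real (m n) *\<^sub>C cinner f (\<Psi> n) *\<^sub>C \<Phi> n) sums (f - N f)" for f
  proof -
    have "c *\<^sub>C x - complex_of_real (1 - t) *\<^sub>C c *\<^sub>C x = complex_of_real t *\<^sub>C c *\<^sub>C x"
      for c t and x :: 'a
    proof -
      have "complex_of_real t * c = c - complex_of_real (1 - t) * c"
        by (simp add: algebra_simps)
      then show ?thesis
        by (simp only: scaleC_scaleC complex_vector.scale_left_diff_distrib)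
    qed
    then show ?thesis
      using sums_diff[OF reconstruct multiplier_sums[OF N_def'], of f f] by (simp add: N_def)
  qed
  then have M: "M = (\<lambda>x. x - N x)"
    unfolding M_def multiplier_def by (intro ext sums_unique[symmetric])
  then have GM: "G \<circ> M = id" "M \<circ> G = id"
    using G by simp_all
  then show "multiplier_invertible (\<lambda>n. complex_of_real (m n)) \<Phi> \<Psi>"
    using G(1) M_sums unfolding multiplier_invertible_def multiplier_defined_def M_def
    by (auto dest: sums_summable)
  \<comment> \<open>\<open>inv\<close> is defined by choice; the two composition identities force it
    to be \<open>G\<close>.\<close>
  have inv: "inv M = G"
    using GM by (intro inv_equality) (simp_all add: fun_eq_iff)
  show "opnorm_sums (\<lambda>k. N ^^ k) (inv M)"
    using G(4) inv by simp
  \<comment> \<open>The two triangle inequalities for this difference give the lower and the upper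
    bound on \<open>norm (G h)\<close>.\<close>
  have h: "h = G h - N (G h)"
    using G(3) by (simp add: fun_eq_iff)
  have "norm h \<le> norm (G h) + norm (N (G h))"
    by (subst h) (rule norm_triangle_ineq4)
  also have "\<dots> \<le> (1 + q) * norm (G h)"
    using N_le[of "G h"] by (simp add: algebra_simps)
  finally have "1 / (1 + q) * norm h \<le> norm (G h)"
    using q0 by (simp add: field_simps)
  then show "1 / (1 + r * sqrt (B * C)) * norm h \<le> norm (inv M h)"
    by (simp add: inv q_def)
  have "norm (G h) - norm (N (G h)) \<le> norm h"
    \<comment> \<open>Occurrence 3 is the \<open>h\<close> on the right-hand side; the first two lie
      inside \<open>G h\<close>.\<close>
    by (subst (3) h) (rule norm_triangle_ineq2)
  then have "(1 - q) * norm (G h) \<le> norm h"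
    using N_le[of "G h"] by (simp add: algebra_simps)
  then have "norm (G h) \<le> 1 / (1 - q) * norm h"
    using q1 by (simp add: field_simps)
  then show "norm (inv M h) \<le> 1 / (1 - r * sqrt (B * C)) * norm h"
    by (simp add: inv q_def)
qed

section \<open>Dual frames, in both orders\<close>

theorem proposition4p6:
  fixes \<Phi> \<Phi>d :: "nat \<Rightarrow> 'a::complex_hilbert"
    and B Bd lam :: real
    and m :: "nat \<Rightarrow> real"
  assumes separable: "\<exists>D :: 'a set. countable D \<and> closure D = UNIV"
    and infinite_dim: "\<not> (\<exists>S :: 'a set. finite S \<and> complex_vector.span S = UNIV)"
    and frame: "is_frame \<Phi>"
    and dual: "dual_frame \<Phi> \<Phi>d"
    and nz: "\<And>n. \<Phi> n \<noteq> 0" and nzd: "\<And>n. \<Phi>d n \<noteq> 0"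
    and B: "upper_frame_bound \<Phi> B" and Bd: "upper_frame_bound \<Phi>d Bd"
    and lam: "0 \<le> lam" "lam < 1 / sqrt (B * Bd)"
    and m: "\<And>n. 1 - lam \<le> m n \<and> m n \<le> 1 + lam"
  shows "multiplier_invertible (\<lambda>n. complex_of_real (m n)) \<Phi> \<Phi>d \<and>
    multiplier_invertible (\<lambda>n. complex_of_real (m n)) \<Phi>d \<Phi> \<and>
    (\<forall>M \<in> {multiplier (\<lambda>n. complex_of_real (m n)) \<Phi> \<Phi>d,
                 multiplier (\<lambda>n. complex_of_real (m n)) \<Phi>d \<Phi>}.
           \<forall>h. 1 / (1 + lam * sqrt (B * Bd)) * norm h \<le> norm (inv M h) \<and>
               norm (inv M h) \<le> 1 / (1 - lam * sqrt (B * Bd)) * norm h) \<and>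
    multiplier_defined (\<lambda>n. complex_of_real (1 - m n)) \<Phi> \<Phi>d \<and>
         opnorm_sums (\<lambda>k. multiplier (\<lambda>n. complex_of_real (1 - m n)) \<Phi> \<Phi>d ^^ k)
           (inv (multiplier (\<lambda>n. complex_of_real (m n)) \<Phi> \<Phi>d)) \<and>
    multiplier_defined (\<lambda>n. complex_of_real (1 - m n)) \<Phi>d \<Phi> \<and>
         opnorm_sums (\<lambda>k. multiplier (\<lambda>n. complex_of_real (1 - m n)) \<Phi>d \<Phi> ^^ k)
           (inv (multiplier (\<lambda>n. complex_of_real (m n)) \<Phi>d \<Phi>))"
proof -
  \<comment> \<open>Any \<open>\<Phi> n\<close> serves as the nonzero vector, for both
    sequences.\<close>
  have \<Phi>: "bessel \<Phi> B" and \<Phi>d: "bessel \<Phi>d Bd"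
    using upper_frame_bound_imp_bessel B Bd nz by blast+
  \<comment> \<open>Division by zero yields 0, so the two bounds on \<open>lam\<close> already force
    \<open>sqrt (B * Bd)\<close> to be positive, and the strict inequality can be multiplied through
    by it.\<close>
  have "0 < 1 / sqrt (B * Bd)"
    using lam by linarith
  then have "0 < sqrt (B * Bd)"
    by (simp only: zero_less_divide_1_iff)
  then have q: "lam * sqrt (B * Bd) < 1"
    using lam(2) by (simp only: pos_less_divide_eq)
  then have q': "lam * sqrt (Bd * B) < 1"
    by (simp add: mult.commute)
  have m': "\<bar>1 - m n\<bar> \<le> lam" for n
    using m[of n] by (simp add: abs_le_iff)
  have sums: "(\<lambda>n. cinner h (\<Phi>d n) *\<^sub>C \<Phi> n) sums h"
      "(\<lambda>n. cinner h (\<Phi> n) *\<^sub>C \<Phi>d n) sums h" for h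
    using dual by (simp_all add: dual_frame_def)
  note 1 = multiplier_near_one[OF \<Phi> \<Phi>d sums(1) m' q]
    and 2 = multiplier_near_one[OF \<Phi>d \<Phi> sums(2) m' q', unfolded mult.commute[of Bd B]]
  show ?thesis
    using 1 2 by simp
qed

end
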